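(* Let $p$ be an odd prime, let $g,s,\ell$ be positive integers, let $r_1,r_2$ be relatively prime positive integers, and let $r=r_1/r_2$ satisfy $r>1/(p-1)$. Let $z=(z_1,\dots,z_{2g+1})$ be variables and let $I^\ell(z,\lambda)=(I_1^\ell,\dots,I_{2g+1}^\ell)$ be the vector of polynomials in $z,\lambda$ with coefficients in $\mathbb Z_p[p^{1/r_2}]$ defined as the coefficient of $t^{\ell p^s-1}$ in $$\Psi_{r,s}(t,z,\lambda)=E_{r,s}(p^r\lambda t)\prod_{i=1}^{2g+1}(t-z_i)^{(p^s-1)/2}\left(\frac1{t-z_1},\dots,\frac1{t-z_{2g+1}}\right).$$ (1) If $\lambda\in\mathbb Z_p[p^{1/r_2}]$, then $I=I^\ell(z,\lambda)$ is a solution modulo $p^s$ of the KZ equations $$\frac{\partial I_j}{\partial z_i}=\frac12\frac{I_i-I_j}{z_i-z_j}\ (i\neq j),\qquad \frac{\partial I_i}{\partial z_i}=p^r\lambda I_i-\frac12\sum_{j\ne i}\frac{I_i-I_j}{z_i-z_j}.$$ (2) If $\lambda\in(\mathbb Z_p[p^{1/r_2}])^\times$, then $I=I^\ell(z,\lambda)$ is a solution modulo $p^s$ of the dynamical equations $$\frac{\partial I_i}{\partial\lambda}=p^rz_iI_i+\frac1{2\lambda}\sum_{j=1}^{2g+1}I_j,\qquad i=1,\dots,2g+1.$$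
   Context: $\mathbb Z_p$ is the ring of $p$-adic integers, $p^{1/r_2}$ is a fixed $r_2$-th root of $p$ in an algebraic closure of $\mathbb Q_p$, and $p^r=(p^{1/r_2})^{r_1}$. Put $d(r,s)=\left[s\frac{p-1}{r(p-1)-1}\right]+1$ (where $[\cdot]$ is the integer part) and $E_{r,s}(t)=\sum_{k=0}^{d(r,s)}\frac{t^k}{k!}$; the polynomial $E_{r,s}(p^r\lambda t)$ in $t,\lambda$ has coefficients in $\mathbb Z_p[p^{1/r_2}]$. "Solution modulo $p^s$" for a given value of $\lambda$ means: after taking the derivatives of the polynomials $I^\ell_i(z,\lambda)$ and substituting the given value of $\lambda$, the difference of the two sides of each equation lies in $p^sR$, where $R=\mathbb Z_p[p^{1/r_2}][z_1,\dots,z_{2g+1}]\big[(z_i-z_j)^{-1},\ i\ne j\big]$. *)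

theory Defs
  imports
    "Berlekamp_Zassenhaus.Finite_Field"
    "HOL-Algebra.Algebraic_Closure_Type"
    "HOL-Algebra.Generated_Rings"
    "HOL-Library.Poly_Mapping"
    "HOL-Computational_Algebra.Computational_Algebra"
begin

text \<open>
  The prime \<open>p\<close> is the cardinality of the type argument. A \<open>p\<close>-adic integer is a compatible
  sequence of residues \<open>x n\<close> modulo \<open>p ^ n\<close>, each represented in \<open>{0..<p ^ n}\<close>
  (the inverse limit of the rings \<open>\<int>/p\<^sup>n\<close>).
\<close>

definition padic_seqs :: "int \<Rightarrow> (nat \<Rightarrow> int) set" where
  "padic_seqs p = {x. (\<forall>n. x n \<in> {0..<p ^ n}) \<and> (\<forall>n. x (Suc n) mod p ^ n = x n)}"

lemma padic_seqs_mod: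
  assumes "p > 0" and "\<And>n. y (Suc n) mod p ^ n = y n mod p ^ n"
  shows "(\<lambda>n. y n mod p ^ n) \<in> padic_seqs p"
  using assms by (simp add: padic_seqs_def mod_mod_cancel)

lemma padic_seqs_Suc: "x \<in> padic_seqs p \<Longrightarrow> x (Suc n) mod p ^ n = x n"
  by (simp add: padic_seqs_def)

lemma padic_seqs_add:
  assumes "x \<in> padic_seqs p" and "y \<in> padic_seqs p"
  shows "(x (Suc n) + y (Suc n)) mod p ^ n = (x n + y n) mod p ^ n"
  by (subst mod_add_eq[symmetric]) (simp only: assms padic_seqs_Suc)

lemma padic_seqs_minus:
  assumes "x \<in> padic_seqs p"
  shows "(- x (Suc n)) mod p ^ n = (- x n) mod p ^ n"
  by (subst mod_minus_eq[symmetric]) (simp only: assms padic_seqs_Suc)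

lemma padic_seqs_mult:
  assumes "x \<in> padic_seqs p" and "y \<in> padic_seqs p"
  shows "(x (Suc n) * y (Suc n)) mod p ^ n = (x n * y n) mod p ^ n"
  by (subst mod_mult_eq[symmetric]) (simp only: assms padic_seqs_Suc)

lemma card_gt_1_int: "int CARD('p :: prime_card) > 1"
  using prime_card_int[where 'a = 'p] prime_gt_1_int by blast

lemma card_gt_0_int: "int CARD('p :: prime_card) > 0"
  using card_gt_1_int[where 'p = 'p] by linarith

typedef ('p :: prime_card) padic_int = "padic_seqs (int CARD('p))"
  using padic_seqs_mod[OF card_gt_0_int[where 'p = 'p], of "\<lambda>_. 0"] by blast

setup_lifting type_definition_padic_int

instantiation padic_int :: (prime_card) comm_ring_1
begin

lift_definition zero_padic_int :: "'a padic_int" is "\<lambda>n. 0"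
  using card_gt_0_int[where 'p = 'a] by (simp add: padic_seqs_def)

lift_definition one_padic_int :: "'a padic_int" is "\<lambda>n. 1 mod int CARD('a) ^ n"
  by (rule padic_seqs_mod[OF card_gt_0_int]) simp

lift_definition plus_padic_int :: "'a padic_int \<Rightarrow> 'a padic_int \<Rightarrow> 'a padic_int"
  is "\<lambda>x y n. (x n + y n) mod int CARD('a) ^ n"
  by (rule padic_seqs_mod[OF card_gt_0_int])
     (rule padic_seqs_add)

lift_definition uminus_padic_int :: "'a padic_int \<Rightarrow> 'a padic_int"
  is "\<lambda>x n. (- x n) mod int CARD('a) ^ n"
  by (rule padic_seqs_mod[OF card_gt_0_int])
     (rule padic_seqs_minus)

lift_definition times_padic_int :: "'a padic_int \<Rightarrow> 'a padic_int \<Rightarrow> 'a padic_int"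
  is "\<lambda>x y n. (x n * y n) mod int CARD('a) ^ n"
  by (rule padic_seqs_mod[OF card_gt_0_int])
     (rule padic_seqs_mult)

definition minus_padic_int :: "'a padic_int \<Rightarrow> 'a padic_int \<Rightarrow> 'a padic_int"
  where "minus_padic_int x y = x + - y"

instance
proof
  fix a b c :: "'a padic_int"
  show "a + b + c = a + (b + c)"
    by transfer (simp add: mod_simps add.assoc)
  show "a + b = b + a"
    by transfer (simp add: add.commute)
  show "0 + a = a"
    by transfer (auto simp: fun_eq_iff padic_seqs_def)
  show "- a + a = 0"
    by transfer (simp add: mod_simps)
  show "a - b = a + - b"
    by (fact minus_padic_int_def)
  show "a * b * c = a * (b * c)"
    by transfer (simp add: mod_simps mult.assoc)
  show "a * b = b * a"
    by transfer (simp add: mult.commute)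
  show "1 * a = a"
    by transfer (auto simp: fun_eq_iff mod_simps padic_seqs_def)
  show "(a + b) * c = a * c + b * c"
    by transfer (simp add: mod_simps distrib_right)
  have "(0 :: int) \<noteq> 1 mod int CARD('a) ^ 1"
    using card_gt_1_int[where 'p = 'a] by simp
  then show "(0 :: 'a padic_int) \<noteq> 1"
    by transfer metis
qed

end

lemma padic_nth_mod:
  "m \<le> n \<Longrightarrow> Rep_padic_int (x :: 'p :: prime_card padic_int) n mod int CARD('p) ^ m = Rep_padic_int x m"
proof (induction n rule: dec_induct)
  case base
  show ?case using Rep_padic_int[of x] by (auto simp: padic_seqs_def)
next
  case (step n)
  have "Rep_padic_int x (Suc n) mod int CARD('p) ^ n = Rep_padic_int x n"
    using Rep_padic_int[of x] by (auto simp: padic_seqs_def)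
  with step show ?case
    by (metis le_imp_power_dvd mod_mod_cancel)
qed

instance padic_int :: (prime_card) idom
proof
  fix x y :: "'a padic_int"
  let ?q = "int CARD('a)"
  have q: "Factorial_Ring.prime ?q" by (rule prime_card_int)
  assume "x \<noteq> 0" "y \<noteq> 0"
  have nz: "\<exists>n. \<not> ?q ^ n dvd Rep_padic_int u n" if "u \<noteq> 0" for u :: "'a padic_int"
  proof (rule ccontr)
    assume "\<not> ?thesis"
    then have d: "?q ^ n dvd Rep_padic_int u n" for n by blast
    have "Rep_padic_int u n \<in> {0..<?q ^ n}" for n
      using Rep_padic_int[of u] by (auto simp: padic_seqs_def)
    with d have "Rep_padic_int u n = 0" for n
      by (metis atLeastLessThan_iff dvd_imp_mod_0 mod_pos_pos_trivial)
    then have "u = 0"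
      by (metis Rep_padic_int_inject zero_padic_int.rep_eq ext)
    with that show False by simp
  qed
  obtain a b where a: "\<not> ?q ^ a dvd Rep_padic_int x a" and b: "\<not> ?q ^ b dvd Rep_padic_int y b"
    using nz \<open>x \<noteq> 0\<close> \<open>y \<noteq> 0\<close> by blast
  let ?X = "Rep_padic_int x (a + b)" and ?Y = "Rep_padic_int y (a + b)"
  have "?X mod ?q ^ a = Rep_padic_int x a" "?Y mod ?q ^ b = Rep_padic_int y b"
    by (rule padic_nth_mod; simp)+
  with a b have X: "\<not> ?q ^ a dvd ?X" and Y: "\<not> ?q ^ b dvd ?Y"
    by (metis dvd_mod_iff dvd_refl)+
  have XY: "?X \<noteq> 0" "?Y \<noteq> 0" using X Y by auto
  have "multiplicity ?q ?X < a" "multiplicity ?q ?Y < b"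
    using X Y q XY by (auto intro: multiplicity_lessI)
  moreover have "multiplicity ?q (?X * ?Y) = multiplicity ?q ?X + multiplicity ?q ?Y"
    using q XY by (intro prime_elem_multiplicity_mult_distrib) auto
  ultimately have "multiplicity ?q (?X * ?Y) < a + b" by linarith
  then have "\<not> ?q ^ (a + b) dvd ?X * ?Y"
    using XY q by (metis less_le_not_le mult_eq_0_iff multiplicity_geI not_prime_unit)
  then have "Rep_padic_int (x * y) (a + b) \<noteq> 0"
    by (simp add: times_padic_int.rep_eq mod_eq_0_iff_dvd)
  then show "x * y \<noteq> 0"
    by (metis zero_padic_int.rep_eq)
qed

type_synonym 'p qp_closure = "'p padic_int fract alg_closure"

definition of_padic_int :: "'p :: prime_card padic_int \<Rightarrow> 'p qp_closure" where
  "of_padic_int x = to_ac (to_fract x)"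

text \<open>\<open>Zp_adjoin \<alpha>\<close> is \<open>\<int>\<^sub>p[\<alpha>]\<close>.\<close>

definition Zp_adjoin :: "'p :: prime_card qp_closure \<Rightarrow> 'p qp_closure set" where
  "Zp_adjoin \<alpha> = generate_ring ring_of_type_algebra (range of_padic_int \<union> {\<alpha>})"

definition Zp_adjoin_units :: "'p :: prime_card qp_closure \<Rightarrow> 'p qp_closure set" where
  "Zp_adjoin_units \<alpha> = {x \<in> Zp_adjoin \<alpha>. \<exists>y \<in> Zp_adjoin \<alpha>. x * y = 1}"

text \<open>
  An element maps exponent vectors to coefficients. Only the variables with index in \<open>{1..n}\<close>,
  \<open>n = 2 * g + 1\<close>, are ever used.
\<close>

type_synonym 'k mpoly = "(nat \<Rightarrow>\<^sub>0 nat) \<Rightarrow>\<^sub>0 'k"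

definition mconst :: "'k :: comm_ring_1 \<Rightarrow> 'k mpoly" where
  "mconst c = Poly_Mapping.single 0 c"

definition mvar :: "nat \<Rightarrow> 'k :: comm_ring_1 mpoly" where
  "mvar i = Poly_Mapping.single (Poly_Mapping.single i 1) 1"

definition mdiff :: "nat \<Rightarrow> 'k :: comm_ring_1 mpoly \<Rightarrow> 'k mpoly" where
  "mdiff i f = (\<Sum>m \<in> Poly_Mapping.keys f.
     Poly_Mapping.single (m - Poly_Mapping.single i 1)
       (of_nat (Poly_Mapping.lookup m i) * Poly_Mapping.lookup f m))"

text \<open>
  \<open>loc_ring \<alpha> n\<close> is
  \<open>\<int>\<^sub>p[\<alpha>][z\<^sub>1, \<dots>, z\<^sub>n][(z\<^sub>i - z\<^sub>j)\<inverse>, i \<noteq> j]\<close>,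
  as a subring of the field of rational functions in \<open>z\<close>.
\<close>

definition loc_ring :: "'p :: prime_card qp_closure \<Rightarrow> nat \<Rightarrow> 'p qp_closure mpoly fract set" where
  "loc_ring \<alpha> n = generate_ring ring_of_type_algebra
     ((\<lambda>c. to_fract (mconst c)) ` Zp_adjoin \<alpha> \<union>
      (\<lambda>i. to_fract (mvar i)) ` {1..n} \<union>
      {inverse (to_fract (mvar i - mvar j)) | i j. i \<in> {1..n} \<and> j \<in> {1..n} \<and> i \<noteq> j})"

definition trunc_deg :: "nat \<Rightarrow> real \<Rightarrow> nat \<Rightarrow> nat" where
  "trunc_deg p r s = nat \<lfloor>real s * ((real p - 1) / (r * (real p - 1) - 1))\<rfloor> + 1"

definition trunc_exp :: "nat \<Rightarrow> real \<Rightarrow> nat \<Rightarrow> 'k :: field poly" where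
  "trunc_exp p r s = (\<Sum>k = 0..trunc_deg p r s. Polynomial.monom (1 / of_nat (fact k)) k)"

text \<open>
  Polynomials in \<open>t, \<lambda>, z\<close> are polynomials in \<open>t\<close> (outermost) whose coefficients are polynomials
  in \<open>\<lambda>\<close> over the polynomials in \<open>z\<close>. The argument \<open>c\<close> below stands for
  \<open>p\<^sup>r\<close>, so that \<open>exp_factor\<close> is \<open>E(c \<lambda> t)\<close>.
\<close>

definition exp_factor :: "nat \<Rightarrow> real \<Rightarrow> nat \<Rightarrow> 'k :: field \<Rightarrow> 'k mpoly poly poly" where
  "exp_factor p r s c =
     pcompose (map_poly (\<lambda>a. [:mconst a:]) (trunc_exp p r s)) [:0, [:0, mconst c:]:]"

definition t_minus_z :: "nat \<Rightarrow> 'k :: field mpoly poly poly" where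
  "t_minus_z i = [:- [:mvar i:], 1:]"

text \<open>
  Component \<open>i\<close> of the master function. The factor \<open>1 / (t - z\<^sub>i)\<close> is cancelled against
  one of the \<open>(p ^ s - 1) / 2 \<ge> 1\<close> factors \<open>t - z\<^sub>i\<close>; see \<open>Psi_quotient\<close>.
\<close>

definition Psi :: "nat \<Rightarrow> real \<Rightarrow> nat \<Rightarrow> 'k :: field \<Rightarrow> nat \<Rightarrow> nat \<Rightarrow> 'k mpoly poly poly" where
  "Psi p r s c n i = exp_factor p r s c *
     (\<Prod>k = 1..n. t_minus_z k ^ (if k = i then (p ^ s - 1) div 2 - 1 else (p ^ s - 1) div 2))"

lemma Psi_quotient:
  fixes c :: "'k :: field"
  assumes "i \<in> {1..n}" and "odd p" and "p > 1" and "s > 0"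
  shows "Psi p r s c n i * t_minus_z i =
    exp_factor p r s c * (\<Prod>k = 1..n. t_minus_z k ^ ((p ^ s - 1) div 2))"
proof -
  let ?M = "(p ^ s - 1) div 2"
  have "p \<ge> 3" using assms by (cases "p = 2") auto
  moreover have "p ^ 1 \<le> p ^ s" using assms by (intro power_increasing) auto
  ultimately have M: "?M > 0" by (simp add: div_greater_zero_iff)
  have split: "(\<Prod>k = 1..n. f k) = f i * (\<Prod>k \<in> {1..n} - {i}. f k)"
    for f :: "nat \<Rightarrow> 'k mpoly poly poly"
    using assms(1) by (intro prod.remove) auto
  have "t_minus_z i ^ (?M - 1) * t_minus_z i = (t_minus_z i :: 'k mpoly poly poly) ^ ?M"
    using M by (simp flip: power_Suc2)
  then show ?thesis
    unfolding Psi_def split by (simp add: mult.assoc mult.left_commute mult.commute)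
qed

definition I_sol ::
  "nat \<Rightarrow> real \<Rightarrow> nat \<Rightarrow> nat \<Rightarrow> 'k :: field \<Rightarrow> nat \<Rightarrow> nat \<Rightarrow> 'k mpoly poly" where
  "I_sol p r s l c n i = Polynomial.coeff (Psi p r s c n i) (l * p ^ s - 1)"

text \<open>Substitution of a value for \<open>\<lambda>\<close>, the result being viewed as a rational function in \<open>z\<close>.\<close>

definition at_lambda :: "'k :: field \<Rightarrow> 'k mpoly poly \<Rightarrow> 'k mpoly fract" where
  "at_lambda lam f = to_fract (poly f (mconst lam))"

text \<open>
  \<open>eq_mod_ps \<alpha> n s u v\<close>: the difference \<open>u - v\<close> lies in \<open>p ^ s R\<close> with
  \<open>R = loc_ring \<alpha> n\<close>.
\<close>

definition eq_mod_ps ::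
  "'p :: prime_card qp_closure \<Rightarrow> nat \<Rightarrow> nat \<Rightarrow>
   'p qp_closure mpoly fract \<Rightarrow> 'p qp_closure mpoly fract \<Rightarrow> bool" where
  "eq_mod_ps \<alpha> n s u v \<longleftrightarrow> u - v \<in> (\<lambda>x. of_nat CARD('p) ^ s * x) ` loc_ring \<alpha> n"

text \<open>
  In both systems \<open>c\<close> stands for \<open>p\<^sup>r\<close>. The polynomials \<open>I i\<close> have \<open>\<lambda>\<close> as
  main variable, hence \<open>map_poly (mdiff i)\<close> is \<open>\<partial>/\<partial>z\<^sub>i\<close> and \<open>pderiv\<close> is
  \<open>\<partial>/\<partial>\<lambda>\<close>.
\<close>

definition KZ_solution_mod ::
  "'p :: prime_card qp_closure \<Rightarrow> 'p qp_closure \<Rightarrow> nat \<Rightarrow> nat \<Rightarrow> 'p qp_closure \<Rightarrow>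
   (nat \<Rightarrow> 'p qp_closure mpoly poly) \<Rightarrow> bool" where
  "KZ_solution_mod \<alpha> c n s lam I \<longleftrightarrow>
     (\<forall>i \<in> {1..n}. \<forall>j \<in> {1..n}. i \<noteq> j \<longrightarrow>
        eq_mod_ps \<alpha> n s
          (at_lambda lam (map_poly (mdiff i) (I j)))
          (1 / 2 * ((at_lambda lam (I i) - at_lambda lam (I j)) / to_fract (mvar i - mvar j)))) \<and>
     (\<forall>i \<in> {1..n}.
        eq_mod_ps \<alpha> n s
          (at_lambda lam (map_poly (mdiff i) (I i)))
          (to_fract (mconst c) * to_fract (mconst lam) * at_lambda lam (I i) -
           1 / 2 * (\<Sum>j \<in> {1..n} - {i}.
             (at_lambda lam (I i) - at_lambda lam (I j)) / to_fract (mvar i - mvar j))))"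

definition dynamical_solution_mod ::
  "'p :: prime_card qp_closure \<Rightarrow> 'p qp_closure \<Rightarrow> nat \<Rightarrow> nat \<Rightarrow> 'p qp_closure \<Rightarrow>
   (nat \<Rightarrow> 'p qp_closure mpoly poly) \<Rightarrow> bool" where
  "dynamical_solution_mod \<alpha> c n s lam I \<longleftrightarrow>
     (\<forall>i \<in> {1..n}.
        eq_mod_ps \<alpha> n s
          (at_lambda lam (pderiv (I i)))
          (to_fract (mconst c) * to_fract (mvar i) * at_lambda lam (I i) +
           1 / (2 * to_fract (mconst lam)) * (\<Sum>j = 1..n. at_lambda lam (I j))))"

end

theory Submission
  imports Defs "HOL-Number_Theory.Cong"
begin

text \<open>
  Let \<open>\<Phi> = E(c \<lambda> t) \<Prod>(t - z\<^sub>k)\<^bsup>M\<^esup>\<close> with \<open>M = (p\<^sup>s - 1) / 2\<close>. For the full exponential series each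
  equation would hold, with \<open>-M\<close> in place of \<open>1 / 2\<close> and up to a \<open>t\<close>-derivative, for the components
  \<open>\<Phi> / (t - z\<^sub>i)\<close> of the integrand. Modulo \<open>p\<^sup>s\<close> one has \<open>-M = 1 / 2\<close>, and the coefficient of
  \<open>t\<^bsup>l p\<^sup>s - 1\<^esup>\<close> in a \<open>t\<close>-derivative vanishes. Truncating the exponential at degree \<open>d\<close> only
  contributes multiples of \<open>c\<^bsup>d + 1\<^esup> / d!\<close>, which is divisible by \<open>p\<^sup>s\<close> because
  \<open>d (r - 1 / (p - 1)) > s\<close> and \<open>v\<^sub>p(d!) \<le> d / (p - 1)\<close>.
\<close>

section \<open>Derivations\<close>

text \<open>The derivatives in t, \<lambda> and each z_i are all instances, so the product rule and
  the exponential rule are proved once for an arbitrary derivation.\<close>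

locale derivation =
  fixes D :: "'a :: comm_ring_1 \<Rightarrow> 'a"
  assumes add: "D (x + y) = D x + D y"
    and mult: "D (x * y) = D x * y + x * D y"
begin

lemma zero [simp]: "D 0 = 0"
  using add[of 0 0] by simp

lemma one [simp]: "D 1 = 0"
  using mult[of 1 1] by simp

lemma sum: "D (\<Sum>x \<in> A. f x) = (\<Sum>x \<in> A. D (f x))"
  by (induction A rule: infinite_finite_induct) (simp_all add: add)

lemma power: "D (x ^ k) = of_nat k * x ^ (k - 1) * D x"
proof (induction k)
  case (Suc k)
  then show ?case
    by (cases k) (simp_all add: mult algebra_simps)
qed simp

text \<open>Lowering an exponent is a function update. The natural subtraction
  \<open>e k - 1\<close> is harmless at \<open>e k = 0\<close>, since the summand then carries the
  factor \<open>of_nat (e k) = 0\<close>.\<close>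

lemma prod_powers:
  assumes "finite A"
  shows "D (\<Prod>k \<in> A. f k ^ e k) =
    (\<Sum>k \<in> A. of_nat (e k) * (\<Prod>j \<in> A. f j ^ (e(k := e k - 1)) j) * D (f k))"
  using assms
proof (induction A rule: finite_induct)
  case (insert a A)
  have "(\<Sum>k \<in> A. of_nat (e k) * (\<Prod>j \<in> insert a A. f j ^ (e(k := e k - 1)) j) * D (f k)) =
    (\<Sum>k \<in> A. f a ^ e a * (of_nat (e k) * (\<Prod>j \<in> A. f j ^ (e(k := e k - 1)) j) * D (f k)))"
    using insert.hyps by (intro sum.cong) (auto simp: algebra_simps)
  moreover have "(\<Prod>j \<in> A. f j ^ (e(a := e a - 1)) j) = (\<Prod>j \<in> A. f j ^ e j)"
    using insert.hyps by (intro prod.cong) auto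
  ultimately show ?case
    using insert by (simp add: mult power sum_distrib_left algebra_simps)
qed simp

end

lemma derivation_pderiv: "derivation (pderiv :: 'a :: idom poly \<Rightarrow> 'a poly)"
  by unfold_locales (simp_all add: pderiv_add pderiv_mult mult.commute)

text \<open>The coefficients of a product are sums of products, so the Leibniz rule survives
  coefficientwise application. Two applications lift \<open>mdiff\<close> to polynomials in t and
  \<lambda>; one lifts \<open>pderiv\<close> in \<lambda>.\<close>

lemma derivation_map_poly:
  assumes "derivation D"
  shows "derivation (map_poly D)"
proof -
  interpret derivation D by fact
  show ?thesis
    by unfold_locales
       (auto intro!: poly_eqI simp: coeff_map_poly coeff_mult add mult sum sum.distrib)
qed

section \<open>Formal partial derivatives in the variables z\<close>

lemma mdiff_single:
  "mdiff i (Poly_Mapping.single m c) =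
    Poly_Mapping.single (m - Poly_Mapping.single i 1) (of_nat (Poly_Mapping.lookup m i) * c)"
  by (cases "c = 0") (simp_all add: mdiff_def)

lemma mdiff_add: "mdiff i (f + g) = mdiff i f + mdiff i g"
proof -
  let ?h = "\<lambda>f m. Poly_Mapping.single (m - Poly_Mapping.single i 1)
     (of_nat (Poly_Mapping.lookup m i) * Poly_Mapping.lookup f m)"
  \<comment> \<open>Cancellation can make the support of \<open>f + g\<close> smaller than the union
    of the supports, so all three sums are extended to this common union by zero terms.\<close>
  have *: "mdiff i u = (\<Sum>m \<in> Poly_Mapping.keys f \<union> Poly_Mapping.keys g. ?h u m)"
    if "Poly_Mapping.keys u \<subseteq> Poly_Mapping.keys f \<union> Poly_Mapping.keys g" for u :: "'a mpoly"
    unfolding mdiff_def using that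
    by (intro sum.mono_neutral_left) (auto simp: in_keys_iff)
  show ?thesis
    by (subst (1 2 3) *)
       (auto simp: lookup_add distrib_left single_add sum.distrib dest: subsetD[OF Poly_Mapping.keys_add])
qed

lemma mpoly_eq_sum_single:
  "f = (\<Sum>m \<in> Poly_Mapping.keys f. Poly_Mapping.single m (Poly_Mapping.lookup f m))"
  by (rule poly_mapping_eqI)
     (auto simp: lookup_sum lookup_single when_def in_keys_iff sum.delta)

lemma mdiff_mult_single:
  fixes a b :: "'k :: comm_ring_1"
  shows "mdiff i (Poly_Mapping.single m a * Poly_Mapping.single n b) =
    mdiff i (Poly_Mapping.single m a) * Poly_Mapping.single n b +
    Poly_Mapping.single m a * mdiff i (Poly_Mapping.single n b)"
proof -
  let ?e = "Poly_Mapping.single i (1 :: nat)"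
  \<comment> \<open>Truncated subtraction of exponent vectors commutes with addition only if the
    exponent of z_i is nonzero. If it is zero, the coefficient in \<open>left\<close> or
    \<open>right\<close> vanishes anyway.\<close>
  have sub: "u - ?e + v = u + v - ?e" if "Poly_Mapping.lookup u i \<noteq> 0" for u v
    using that by (intro poly_mapping_eqI) (auto simp: lookup_add lookup_minus lookup_single when_def)
  have left: "Poly_Mapping.single (m - ?e + n) (of_nat (Poly_Mapping.lookup m i) * a * b) =
      Poly_Mapping.single (m + n - ?e) (of_nat (Poly_Mapping.lookup m i) * a * b)"
    using sub[of m n] by (cases "Poly_Mapping.lookup m i = 0") auto
  have right: "Poly_Mapping.single (m + (n - ?e)) (a * (of_nat (Poly_Mapping.lookup n i) * b)) =
      Poly_Mapping.single (m + n - ?e) (a * (of_nat (Poly_Mapping.lookup n i) * b))"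
    using sub[of n m] by (cases "Poly_Mapping.lookup n i = 0") (auto simp: add.commute)
  show ?thesis
    unfolding mult_single mdiff_single left right
    by (simp add: lookup_add algebra_simps flip: single_add)
qed

text \<open>Both sides of the Leibniz rule are biadditive, so it suffices to expand into monomials
  and apply \<open>mdiff_mult_single\<close>.\<close>

lemma derivation_mdiff: "derivation (mdiff i :: 'k :: comm_ring_1 mpoly \<Rightarrow> 'k mpoly)"
proof
  show add: "mdiff i (f + g) = mdiff i f + mdiff i g" for f g :: "'k mpoly"
    by (rule mdiff_add)
  have zero: "mdiff i 0 = (0 :: 'k mpoly)"
    by (simp add: mdiff_def)
  have sum: "mdiff i (\<Sum>x \<in> A. f x) = (\<Sum>x \<in> A. mdiff i (f x))"
    for A and f :: "(nat \<Rightarrow>\<^sub>0 nat) \<Rightarrow> 'k mpoly"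
    by (induction A rule: infinite_finite_induct) (simp_all add: add zero)
  fix f g :: "'k mpoly"
  let ?S = "\<lambda>f :: 'k mpoly. \<Sum>m \<in> Poly_Mapping.keys f. Poly_Mapping.single m (Poly_Mapping.lookup f m)"
  have "mdiff i (?S f * ?S g) = mdiff i (?S f) * ?S g + ?S f * mdiff i (?S g)"
    by (simp only: sum_product sum mdiff_mult_single sum.distrib)
  then show "mdiff i (f * g) = mdiff i f * g + f * mdiff i g"
    by (simp only: mpoly_eq_sum_single[symmetric])
qed

section \<open>The master polynomial\<close>

lemma mconst_0 [simp]: "mconst 0 = 0"
  by (simp add: mconst_def)

lemma mconst_1 [simp]: "mconst 1 = 1"
  by (simp add: mconst_def)

lemma mconst_eq_0_iff: "mconst a = 0 \<longleftrightarrow> a = 0"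
  by (metis lookup_single_eq lookup_zero mconst_0 mconst_def)

lemma mconst_mult: "mconst (a * b) = mconst a * mconst b"
  by (simp add: mconst_def mult_single)

lemma mconst_power: "mconst (a ^ k) = mconst a ^ k"
  by (induction k) (simp_all add: mconst_mult)

lemma mconst_of_nat: "mconst (of_nat k) = of_nat k"
  by (simp add: mconst_def)

lemma mdiff_mconst [simp]: "mdiff i (mconst a) = 0"
  by (simp add: mconst_def mdiff_single)

lemma mdiff_mvar: "mdiff i (mvar j :: 'k :: comm_ring_1 mpoly) = of_bool (i = j)"
  by (auto simp: mvar_def mdiff_single lookup_single)

lemma mvar_eq_iff: "(mvar i :: 'k :: comm_ring_1 mpoly) = mvar j \<longleftrightarrow> i = j"
proof
  assume "(mvar i :: 'k mpoly) = mvar j"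
  then have "mdiff i (mvar i :: 'k mpoly) = mdiff i (mvar j)"
    by simp
  then show "i = j"
    by (simp add: mdiff_mvar split: if_splits)
qed simp

lemma mdiff_0 [simp]: "mdiff i 0 = 0"
  by (simp add: mdiff_def)

lemma mdiff_1 [simp]: "mdiff i 1 = 0"
  using mdiff_mconst[of i 1] by simp

lemma mdiff_uminus: "mdiff i (- f) = - mdiff i (f :: 'k :: comm_ring_1 mpoly)"
  using mdiff_add[of i f "- f"] by (simp add: add_eq_0_iff)

section \<open>The three derivations on polynomials in t, \<lambda> and z, and the truncated
  exponential\<close>

abbreviation ddz :: "nat \<Rightarrow> 'k :: comm_ring_1 mpoly poly poly \<Rightarrow> 'k mpoly poly poly" where
  "ddz i \<equiv> map_poly (map_poly (mdiff i))"

abbreviation ddlam :: "'k :: field mpoly poly poly \<Rightarrow> 'k mpoly poly poly" where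
  "ddlam \<equiv> map_poly pderiv"

interpretation ddz: derivation "ddz i :: 'k :: field mpoly poly poly \<Rightarrow> _"
  by (intro derivation_map_poly derivation_mdiff)

interpretation ddlam: derivation "ddlam :: 'k :: field mpoly poly poly \<Rightarrow> _"
  by (intro derivation_map_poly derivation_pderiv)

interpretation ddt: derivation "pderiv :: 'k :: field mpoly poly poly \<Rightarrow> _"
  by (rule derivation_pderiv)

definition exp_trunc :: "nat \<Rightarrow> 'k :: field \<Rightarrow> 'k mpoly poly poly" where
  "exp_trunc d c = (\<Sum>k < d. [:[:mconst (1 / of_nat (fact k)):]:] * [:0, [:0, mconst c:]:] ^ k)"

text \<open>A derivation sends the truncation at degree d to the truncation below degree d, times
  the inner derivative. The term of degree d is split off because it is the whole deviation from the
  rule for the full exponential.\<close>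

definition exp_top :: "nat \<Rightarrow> 'k :: field \<Rightarrow> 'k mpoly poly poly" where
  "exp_top d c = [:[:mconst (1 / of_nat (fact d)):]:] * [:0, [:0, mconst c:]:] ^ d"

lemma exp_factor_eq:
  "exp_factor p r s c = exp_trunc (trunc_deg p r s) c + exp_top (trunc_deg p r s) (c :: 'k :: field)"
proof -
  let ?d = "trunc_deg p r s"
  let ?h = "\<lambda>a :: 'k. [:mconst a:]"
  have "map_poly ?h (trunc_exp p r s) =
      (\<Sum>k = 0..?d. Polynomial.monom (?h (1 / of_nat (fact k))) k)"
    unfolding trunc_exp_def
    by (rule poly_eqI) (simp add: coeff_map_poly Polynomial.coeff_sum sum.delta)
  then have "exp_factor p r s c =
      (\<Sum>k = 0..?d. [:?h (1 / of_nat (fact k)):] * [:0, [:0, mconst c:]:] ^ k)"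
    unfolding exp_factor_def
    by (simp add: pcompose_sum) (simp add: pcompose_altdef map_poly_monom poly_monom)
  then show ?thesis
    by (simp add: exp_trunc_def exp_top_def atLeast0AtMost lessThan_Suc_atMost[symmetric])
qed

lemma const_times_linear_power:
  "[:[:mconst a:]:] * [:0, [:0, mconst c:]:] ^ k =
    Polynomial.monom (Polynomial.monom (mconst (a * c ^ k)) k) k"
proof -
  have "[:0, [:0, mconst c:]:] = Polynomial.monom (Polynomial.monom (mconst c) 1) 1"
    by (simp add: Polynomial.monom_Suc Polynomial.monom_0)
  then show ?thesis
    by (simp add: Polynomial.monom_power Polynomial.smult_monom mconst_mult mconst_power)
qed

text \<open>The constants \<open>f k\<close> behave like 1/k!, which is expressed by a recurrence so
  that the ring needs no division. Each term differentiates to the preceding term times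
  \<open>D x\<close>.\<close>

lemma (in derivation) exp_sum:
  fixes f :: "nat \<Rightarrow> 'a"
  assumes "\<And>k. D (f k) = 0" and "\<And>k. of_nat (Suc k) * f (Suc k) = f k"
  shows "D (\<Sum>k \<le> d. f k * x ^ k) = (\<Sum>k < d. f k * x ^ k) * D x"
proof (induction d)
  case (Suc d)
  have "D (f (Suc d) * x ^ Suc d) = (of_nat (Suc d) * f (Suc d)) * x ^ d * D x"
    by (simp only: mult power assms(1)) (simp add: algebra_simps)
  then have "D (f (Suc d) * x ^ Suc d) = f d * x ^ d * D x"
    by (simp only: assms(2))
  then show ?case
    using Suc by (simp add: add algebra_simps)
qed (simp add: assms)

text \<open>Characteristic zero makes \<open>1 / of_nat (fact k)\<close> a true inverse, so that the
  recurrence of \<open>exp_sum\<close> holds; with the convention 1/0 = 0 it would fail in positive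
  characteristic.\<close>

lemma derivation_exp_factor:
  fixes c :: "'k :: field"
  assumes "derivation D" and "\<And>a. D [:[:mconst a:]:] = 0"
    and char_0: "\<And>k. k > 0 \<Longrightarrow> of_nat k \<noteq> (0 :: 'k)"
  shows "D (exp_factor p r s c) = exp_trunc (trunc_deg p r s) c * D [:0, [:0, mconst c:]:]"
proof -
  interpret derivation D by fact
  have "of_nat (Suc k) * [:[:mconst (1 / of_nat (fact (Suc k)) :: 'k):]:] =
      [:[:mconst (1 / of_nat (fact k)):]:]" for k
  proof -
    have "of_nat (Suc k) * (1 / of_nat (fact (Suc k)) :: 'k) = 1 / of_nat (fact k)"
      using char_0[of "Suc k"] by (simp only: fact_Suc of_nat_mult of_nat_id) simp
    then have "mconst (of_nat (Suc k)) * mconst (1 / of_nat (fact (Suc k)) :: 'k) = mconst (1 / of_nat (fact k))"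
      by (simp only: mconst_mult[symmetric])
    then show ?thesis
      by (simp add: mconst_of_nat of_nat_poly del: of_nat_Suc)
  qed
  then show ?thesis
    using exp_sum[of "\<lambda>k. [:[:mconst (1 / of_nat (fact k)):]:]" "[:0, [:0, mconst c:]:]" "trunc_deg p r s"]
    by (simp add: exp_factor_eq exp_trunc_def exp_top_def assms(2) lessThan_Suc_atMost[symmetric])
qed

text \<open>With the exponents given as a function, division by t - z_i and differentiation both
  become updates of that function.\<close>

definition z_prod :: "nat \<Rightarrow> (nat \<Rightarrow> nat) \<Rightarrow> 'k :: field mpoly poly poly" where
  "z_prod n e = (\<Prod>k = 1..n. t_minus_z k ^ e k)"

lemma z_prod_remove:
  assumes "k \<in> {1..n}" and "e k > 0"
  shows "(z_prod n e :: 'k :: field mpoly poly poly) = t_minus_z k * z_prod n (e(k := e k - 1))"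
proof -
  have split: "(z_prod n e' :: 'k mpoly poly poly) = t_minus_z k ^ e' k * (\<Prod>j \<in> {1..n} - {k}. t_minus_z j ^ e' j)" for e'
    unfolding z_prod_def using assms(1) by (intro prod.remove) auto
  have "(\<Prod>j \<in> {1..n} - {k}. t_minus_z j ^ (e(k := e k - 1)) j) =
      (\<Prod>j \<in> {1..n} - {k}. t_minus_z j ^ e j :: 'k mpoly poly poly)"
    by (intro prod.cong) auto
  moreover have "t_minus_z k ^ e k = t_minus_z k * (t_minus_z k :: 'k mpoly poly poly) ^ (e k - 1)"
    using assms(2) by (simp add: power_eq_if)
  ultimately show ?thesis
    by (simp only: split fun_upd_same mult.assoc)
qed

lemma derivation_z_prod:
  assumes "derivation D"
  shows "D (z_prod n e) = (\<Sum>k = 1..n. of_nat (e k) * z_prod n (e(k := e k - 1)) * D (t_minus_z k))"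
  unfolding z_prod_def by (rule derivation.prod_powers[OF assms]) simp

lemma Psi_eq:
  "Psi p r s c n i =
    exp_factor p r s c * z_prod n ((\<lambda>_. (p ^ s - 1) div 2)(i := (p ^ s - 1) div 2 - 1))"
  unfolding Psi_def z_prod_def by (auto intro!: prod.cong arg_cong2[of _ _ _ _ "(*)"])

lemma ddz_t_minus_z: "ddz i (t_minus_z k :: 'k :: field mpoly poly poly) = - of_bool (i = k)"
  by (simp add: t_minus_z_def Polynomial.map_poly_pCons map_poly_1 mdiff_uminus mdiff_mvar one_pCons)

lemma ddlam_t_minus_z: "ddlam (t_minus_z k) = 0"
  by (simp add: t_minus_z_def Polynomial.map_poly_pCons pderiv_minus pderiv_pCons)

lemma ddt_t_minus_z: "pderiv (t_minus_z k) = 1"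
  by (simp add: t_minus_z_def pderiv_pCons)


section \<open>Specialising \<lambda> and the integrality of coefficients\<close>

lemma to_fract_of_nat: "to_fract (of_nat k) = of_nat k"
  by (induction k) simp_all

lemma to_fract_power: "to_fract (x ^ k) = to_fract x ^ k"
  by (induction k) simp_all

lemma at_lambda_simps [simp]:
  "at_lambda lam 0 = 0"
  "at_lambda lam 1 = 1"
  "at_lambda lam (f + g) = at_lambda lam f + at_lambda lam g"
  "at_lambda lam (f - g) = at_lambda lam f - at_lambda lam g"
  "at_lambda lam (- f) = - at_lambda lam f"
  "at_lambda lam (f * g) = at_lambda lam f * at_lambda lam g"
  "at_lambda lam [:a:] = to_fract a"
  "at_lambda lam [:a, b:] = to_fract a + to_fract (mconst lam) * to_fract b"
  by (simp_all add: at_lambda_def)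

lemma at_lambda_sum: "at_lambda lam (\<Sum>x \<in> A. f x) = (\<Sum>x \<in> A. at_lambda lam (f x))"
  by (induction A rule: infinite_finite_induct) simp_all

lemma at_lambda_monom:
  "at_lambda lam (Polynomial.monom (mconst a) k) = to_fract (mconst (a * lam ^ k))"
  by (simp add: at_lambda_def poly_monom mconst_mult mconst_power)

text \<open>\<open>S\<close> is a parameter because the predicate serves both for the ring
  \<open>R\<close> and for its ideal p^s R.\<close>

definition coeffs_in :: "'k :: field \<Rightarrow> 'k mpoly fract set \<Rightarrow> 'k mpoly poly poly \<Rightarrow> bool" where
  "coeffs_in lam S P \<longleftrightarrow> (\<forall>m. at_lambda lam (Polynomial.coeff P m) \<in> S)"

lemma coeffs_in_monom:
  assumes "0 \<in> S" and "to_fract (mconst (a * lam ^ k)) \<in> S"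
  shows "coeffs_in lam S (Polynomial.monom (Polynomial.monom (mconst a) k) m)"
  unfolding coeffs_in_def using assms by (simp add: at_lambda_monom)

text \<open>Everything the computation uses about the base ring. \<open>coeff_in\<close> makes E(c
  \<lambda> t) integral. \<open>top_in\<close> makes the truncation error vanish modulo p^s; its
  extra factor \<open>c\<close> comes from the inner derivative of c \<lambda> t.\<close>

locale integral_data =
  fixes p s n :: nat and r :: real and c lam :: "'k :: field" and R :: "'k mpoly fract set"
  assumes one_in: "1 \<in> R"
    and add_in: "x \<in> R \<Longrightarrow> y \<in> R \<Longrightarrow> x + y \<in> R"
    and uminus_in: "x \<in> R \<Longrightarrow> - x \<in> R"
    and mult_in: "x \<in> R \<Longrightarrow> y \<in> R \<Longrightarrow> x * y \<in> R"
    and mvar_in: "i \<in> {1..n} \<Longrightarrow> to_fract (mvar i) \<in> R"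
    and half_in: "1 / 2 \<in> R"
    and lam_in: "to_fract (mconst lam) \<in> R"
    and coeff_in: "to_fract (mconst (1 / of_nat (fact k) * c ^ k)) \<in> R"
    and top_in: "to_fract (mconst (1 / of_nat (fact (trunc_deg p r s)) * c ^ Suc (trunc_deg p r s)))
      \<in> (\<lambda>x. of_nat p ^ s * x) ` R"
    and char_0: "k > 0 \<Longrightarrow> of_nat k \<noteq> (0 :: 'k)"
    and odd_p: "odd p" and p_gt_1: "p > 1" and s_pos: "s > 0"
begin

abbreviation "M \<equiv> (p ^ s - 1) div 2"
abbreviation "pR \<equiv> (\<lambda>x. of_nat p ^ s * x) ` R"
abbreviation "d \<equiv> trunc_deg p r s"
abbreviation "E \<equiv> exp_factor p r s c"
abbreviation "z_pow e \<equiv> z_prod n e :: 'k mpoly poly poly"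

text \<open>For distinct i, j in the index range this is the quotient of
  \<open>E * z_pow (\<lambda>_. M)\<close> by (t - z_i)(t - z_j), a polynomial because
  \<open>M > 0\<close>.\<close>

definition Phi2 :: "nat \<Rightarrow> nat \<Rightarrow> 'k mpoly poly poly" where
  "Phi2 i j = E * z_pow ((\<lambda>_. M)(i := M - 1, j := M - 1))"

lemma p_pow: "p ^ s = 2 * M + 1"
proof -
  have "odd (p ^ s)"
    using odd_p by simp
  then obtain k where "p ^ s = 2 * k + 1"
    by (rule oddE)
  then show ?thesis
    by simp
qed

lemma M_pos: "M > 0"
proof -
  have "p ^ 1 \<le> p ^ s"
    using p_gt_1 s_pos by (intro power_increasing) auto
  moreover have "p \<ge> 3"
    using p_gt_1 odd_p by (cases "p = 2") auto
  ultimately show ?thesis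
    by (simp add: div_greater_zero_iff)
qed

lemma of_nat_p_pow: "(of_nat p :: 'a :: semiring_1) ^ s = 2 * of_nat M + 1"
  using arg_cong[OF p_pow, of of_nat] by (simp only: of_nat_power of_nat_add of_nat_mult of_nat_numeral of_nat_1)

lemma two_neq_0: "(2 :: 'k mpoly fract) \<noteq> 0"
proof -
  have "to_fract (mconst (2 :: 'k)) = (2 :: 'k mpoly fract)"
    using mconst_of_nat[of 2, where 'a = 'k] to_fract_of_nat[of 2, where 'a = "'k mpoly"] by simp
  moreover have "mconst (2 :: 'k) \<noteq> 0"
    using char_0[of 2] by (simp add: mconst_eq_0_iff)
  ultimately show ?thesis
    by (metis to_fract_eq_0_iff)
qed

section \<open>Closure properties of \<open>R\<close> and of the ideal p^s R\<close>

lemma zero_in: "0 \<in> R"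
  using add_in[OF one_in uminus_in[OF one_in]] by simp

lemma sum_in: "(\<And>x. x \<in> A \<Longrightarrow> f x \<in> R) \<Longrightarrow> (\<Sum>x \<in> A. f x) \<in> R"
  by (induction A rule: infinite_finite_induct) (auto intro: zero_in add_in)

lemma power_in: "x \<in> R \<Longrightarrow> x ^ k \<in> R"
  by (induction k) (auto intro: one_in mult_in)

lemma of_nat_in: "of_nat k \<in> R"
  by (induction k) (auto intro: zero_in one_in add_in)

lemma ideal_zero: "0 \<in> pR"
  using zero_in by force

lemma ideal_uminus: "x \<in> pR \<Longrightarrow> - x \<in> pR"
  unfolding image_iff by (metis uminus_in mult_minus_right)

lemma ideal_add: "x \<in> pR \<Longrightarrow> y \<in> pR \<Longrightarrow> x + y \<in> pR"
  unfolding image_iff by (metis add_in distrib_left)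

lemma ideal_diff: "x \<in> pR \<Longrightarrow> y \<in> pR \<Longrightarrow> x - y \<in> pR"
  using ideal_add[of x "- y"] ideal_uminus by simp

lemma ideal_mult: "x \<in> pR \<Longrightarrow> y \<in> R \<Longrightarrow> x * y \<in> pR"
  unfolding image_iff by (metis mult_in mult.assoc)

lemma ideal_sum: "(\<And>x. x \<in> A \<Longrightarrow> f x \<in> pR) \<Longrightarrow> (\<Sum>x \<in> A. f x) \<in> pR"
proof (induction A rule: infinite_finite_induct)
  case (insert a A)
  then have "f a + (\<Sum>x \<in> A. f x) \<in> pR"
    by (intro ideal_add) blast+
  then show ?case
    by (simp only: sum.insert[OF insert.hyps])
qed (metis sum.infinite ideal_zero, metis sum.empty ideal_zero)

lemma coeffs_in_mult: "coeffs_in lam R P \<Longrightarrow> coeffs_in lam R Q \<Longrightarrow> coeffs_in lam R (P * Q)"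
  unfolding coeffs_in_def coeff_mult at_lambda_sum at_lambda_simps
  by (intro allI sum_in mult_in) blast+

lemma coeffs_in_ideal_mult: "coeffs_in lam pR P \<Longrightarrow> coeffs_in lam R Q \<Longrightarrow> coeffs_in lam pR (P * Q)"
  unfolding coeffs_in_def coeff_mult at_lambda_sum at_lambda_simps
  by (intro allI ideal_sum ideal_mult) blast+

lemma coeffs_in_add: "coeffs_in lam R P \<Longrightarrow> coeffs_in lam R Q \<Longrightarrow> coeffs_in lam R (P + Q)"
  by (simp add: coeffs_in_def add_in)

lemma coeffs_in_sum: "(\<And>x. x \<in> A \<Longrightarrow> coeffs_in lam R (f x)) \<Longrightarrow> coeffs_in lam R (\<Sum>x \<in> A. f x)"
  unfolding coeffs_in_def Polynomial.coeff_sum at_lambda_sum by (intro allI sum_in) blast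

lemma coeffs_in_1: "coeffs_in lam R 1"
  by (auto simp: coeffs_in_def one_in zero_in coeff_1)

lemma coeffs_in_power: "coeffs_in lam R P \<Longrightarrow> coeffs_in lam R (P ^ k)"
  by (induction k) (auto intro: coeffs_in_1 coeffs_in_mult)

lemma coeffs_in_prod: "(\<And>x. x \<in> A \<Longrightarrow> coeffs_in lam R (f x)) \<Longrightarrow> coeffs_in lam R (\<Prod>x \<in> A. f x)"
  by (induction A rule: infinite_finite_induct) (auto intro: coeffs_in_1 coeffs_in_mult)

lemma coeffs_in_z_prod: "coeffs_in lam R (z_pow e)"
  unfolding z_prod_def
  by (intro coeffs_in_prod coeffs_in_power)
     (auto simp: coeffs_in_def t_minus_z_def coeff_pCons one_in zero_in uminus_in mvar_in split: nat.split)

lemma coeffs_in_exp_factor: "coeffs_in lam R E"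
proof -
  have "to_fract (mconst (1 / of_nat (fact k) * c ^ k * lam ^ k)) \<in> R" for k
    unfolding mconst_mult[of _ "lam ^ k"] to_fract_mult
    using coeff_in lam_in power_in
    by (intro mult_in) (simp_all add: mconst_power to_fract_power)
  then show ?thesis
    unfolding exp_factor_eq exp_trunc_def exp_top_def const_times_linear_power
    by (intro coeffs_in_add coeffs_in_sum coeffs_in_monom zero_in)
qed

lemma to_fract_lam_pow: "to_fract (mconst (lam ^ k)) \<in> R"
  using power_in[OF lam_in] by (simp add: mconst_power to_fract_power)

lemma top_lam_pow: "to_fract (mconst (1 / of_nat (fact d) * c ^ Suc d * lam ^ k)) \<in> pR"
  unfolding mconst_mult[of _ "lam ^ k"] to_fract_mult
  by (intro ideal_mult top_in to_fract_lam_pow)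

text \<open>This is the error term of the t-derivative: the top term times the inner derivative c
  \<lambda>. It is a single monomial with coefficient c^(d+1)/d!, which \<open>top_in\<close>
  covers. The next lemma treats the inner derivative c t of the \<lambda>-derivative in the same
  way.\<close>

lemma coeffs_in_top_lam: "coeffs_in lam pR (exp_top d c * [:[:0, mconst c:]:])"
proof -
  have "[:[:0, mconst c:]:] = Polynomial.monom (Polynomial.monom (mconst c) 1) 0"
    by (simp add: Polynomial.monom_Suc Polynomial.monom_0)
  then have "exp_top d c * [:[:0, mconst c:]:] =
      Polynomial.monom (Polynomial.monom (mconst (1 / of_nat (fact d) * c ^ Suc d)) (Suc d)) d"
    unfolding exp_top_def const_times_linear_power
    by (simp only: mult_monom mconst_mult[symmetric]) (simp add: mult_ac)
  then show ?thesis
    using coeffs_in_monom ideal_zero top_lam_pow by metis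
qed

lemma coeffs_in_top_t: "coeffs_in lam pR (exp_top d c * [:0, [:mconst c:]:])"
proof -
  have "[:0, [:mconst c:]:] = Polynomial.monom (Polynomial.monom (mconst c) 0) 1"
    by (simp add: Polynomial.monom_Suc Polynomial.monom_0)
  then have "exp_top d c * [:0, [:mconst c:]:] =
      Polynomial.monom (Polynomial.monom (mconst (1 / of_nat (fact d) * c ^ Suc d)) d) (Suc d)"
    unfolding exp_top_def const_times_linear_power
    by (simp only: mult_monom mconst_mult[symmetric]) (simp add: mult_ac)
  then show ?thesis
    using coeffs_in_monom ideal_zero top_lam_pow by metis
qed

section \<open>Differential identities for the integrand\<close>

lemma ddz_exp_factor: "ddz i E = 0"
  by (subst derivation_exp_factor[OF derivation_map_poly[OF derivation_map_poly[OF derivation_mdiff]]])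
     (auto simp: Polynomial.map_poly_pCons char_0)

lemma ddlam_exp_factor: "ddlam E = exp_trunc d c * [:0, [:mconst c:]:]"
  by (subst derivation_exp_factor[OF derivation_map_poly[OF derivation_pderiv]])
     (auto simp: Polynomial.map_poly_pCons pderiv_pCons char_0)

lemma ddt_exp_factor: "pderiv E = exp_trunc d c * [:[:0, mconst c:]:]"
  by (subst derivation_exp_factor[OF derivation_pderiv])
     (auto simp: pderiv_pCons char_0)

text \<open>Partial fractions: 1/(t - z_i) - 1/(t - z_j) = (z_i - z_j) / ((t - z_i)(t -
  z_j)).\<close>

lemma Psi_diff:
  assumes "i \<in> {1..n}" "j \<in> {1..n}" "i \<noteq> j"
  shows "Psi p r s c n i - Psi p r s c n j = [:[:mvar i - mvar j:]:] * Phi2 i j"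
proof -
  have i: "z_pow ((\<lambda>_. M)(i := M - 1)) = t_minus_z j * z_pow ((\<lambda>_. M)(i := M - 1, j := M - 1))"
    using assms M_pos by (subst z_prod_remove[of j]) auto
  have j: "z_pow ((\<lambda>_. M)(j := M - 1)) = t_minus_z i * z_pow ((\<lambda>_. M)(i := M - 1, j := M - 1))"
    using assms M_pos by (subst z_prod_remove[of i]) (auto simp: fun_upd_twist)
  have "[:[:mvar i - mvar j:]:] = t_minus_z j - (t_minus_z i :: 'k mpoly poly poly)"
    by (simp add: t_minus_z_def)
  then show ?thesis
    unfolding Psi_eq Phi2_def i j by (simp only: left_diff_distrib right_diff_distrib mult_ac)
qed

text \<open>Only the factor (t - z_i)^M depends on z_i; differentiating it gives -M and lowers its
  exponent by one.\<close>

lemma ddz_Psi_other: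
  assumes "i \<in> {1..n}" "j \<in> {1..n}" "i \<noteq> j"
  shows "ddz i (Psi p r s c n j) = - (of_nat M * Phi2 i j)"
proof -
  let ?e = "(\<lambda>_. M)(j := M - 1)"
  have "ddz i (z_pow ?e) =
      (\<Sum>k = 1..n. of_nat (?e k) * z_pow (?e(k := ?e k - 1)) * - of_bool (i = k))"
    by (simp only: derivation_z_prod[OF ddz.derivation_axioms] ddz_t_minus_z)
  also have "\<dots> = - (of_nat (?e i) * z_pow (?e(i := ?e i - 1)))"
    using assms by (simp add: sum_negf sum.delta if_distrib of_bool_def cong: if_cong)
  finally show ?thesis
    using assms by (simp add: Psi_eq ddz.mult ddz_exp_factor Phi2_def fun_upd_twist mult_ac)
qed

text \<open>The index i is separated because its exponent drops a second time. If
  \<open>M = 1\<close>, the subtraction \<open>M - 1 - 1\<close> truncates, but the factor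
  \<open>of_nat (M - 1)\<close> is then zero.\<close>

lemma z_pow_step:
  assumes "i \<in> {1..n}"
  shows "(\<Sum>k = 1..n. of_nat (((\<lambda>_. M)(i := M - 1)) k) *
      z_pow (((\<lambda>_. M)(i := M - 1))(k := ((\<lambda>_. M)(i := M - 1)) k - 1))) =
    of_nat (M - 1) * z_pow ((\<lambda>_. M)(i := M - 1 - 1)) +
    of_nat M * (\<Sum>j \<in> {1..n} - {i}. z_pow ((\<lambda>_. M)(i := M - 1, j := M - 1)))"
  using assms by (subst sum.remove[of _ i]) (auto simp: sum_distrib_left intro!: sum.cong)

text \<open>The sum of the two derivatives annihilates t - z_i, so the doubly lowered power of t -
  z_i cancels. What remains is the t-derivative of the exponential and of the factors with j
  \<noteq> i.\<close>

lemma ddz_plus_ddt_Psi: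
  assumes "i \<in> {1..n}"
  shows "ddz i (Psi p r s c n i) + pderiv (Psi p r s c n i) =
    exp_trunc d c * [:[:0, mconst c:]:] * z_pow ((\<lambda>_. M)(i := M - 1)) +
    of_nat M * (\<Sum>j \<in> {1..n} - {i}. Phi2 i j)"
proof -
  let ?e = "(\<lambda>_. M)(i := M - 1)"
  have "ddz i (z_pow ?e) =
      (\<Sum>k = 1..n. of_nat (?e k) * z_pow (?e(k := ?e k - 1)) * - of_bool (i = k))"
    by (simp only: derivation_z_prod[OF ddz.derivation_axioms] ddz_t_minus_z)
  also have "\<dots> = - (of_nat (M - 1) * z_pow ((\<lambda>_. M)(i := M - 1 - 1)))"
    using assms by (simp add: sum_negf sum.delta if_distrib of_bool_def cong: if_cong)
  finally have z: "ddz i (z_pow ?e) = - (of_nat (M - 1) * z_pow ((\<lambda>_. M)(i := M - 1 - 1)))" .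
  have t: "pderiv (z_pow ?e) = of_nat (M - 1) * z_pow ((\<lambda>_. M)(i := M - 1 - 1)) +
      of_nat M * (\<Sum>j \<in> {1..n} - {i}. z_pow ((\<lambda>_. M)(i := M - 1, j := M - 1)))"
    using z_pow_step[OF assms]
    by (simp only: derivation_z_prod[OF ddt.derivation_axioms] ddt_t_minus_z mult_1_right)
  have "ddz i (Psi p r s c n i) = E * ddz i (z_pow ?e)"
    by (simp only: Psi_eq ddz.mult ddz_exp_factor mult_zero_left add_0_left)
  moreover have "pderiv (Psi p r s c n i) =
      exp_trunc d c * [:[:0, mconst c:]:] * z_pow ?e + E * pderiv (z_pow ?e)"
    by (simp only: Psi_eq ddt.mult ddt_exp_factor)
  moreover have "(\<Sum>j \<in> {1..n} - {i}. Phi2 i j) =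
      E * (\<Sum>j \<in> {1..n} - {i}. z_pow ((\<lambda>_. M)(i := M - 1, j := M - 1)))"
    by (simp only: Phi2_def sum_distrib_left)
  ultimately show ?thesis
    unfolding z t by (simp only: distrib_left mult_minus_right mult.left_commute[of _ "of_nat M"]) simp
qed

lemma ddlam_Psi:
  "ddlam (Psi p r s c n i) = exp_trunc d c * [:0, [:mconst c:]:] * z_pow ((\<lambda>_. M)(i := M - 1))"
proof -
  have "ddlam (z_pow e) = 0" for e
    by (simp only: derivation_z_prod[OF ddlam.derivation_axioms] ddlam_t_minus_z mult_zero_right sum.neutral_const)
  then show ?thesis
    by (simp only: Psi_eq ddlam.mult ddlam_exp_factor mult_zero_right add_0_right)
qed

text \<open>The t-derivative of the full product produces the sum of all components, which is how
  the sum over j enters the dynamical equation.\<close>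

lemma ddt_master:
  "pderiv (E * z_pow (\<lambda>_. M)) =
    exp_trunc d c * [:[:0, mconst c:]:] * z_pow (\<lambda>_. M) + of_nat M * (\<Sum>j = 1..n. Psi p r s c n j)"
proof -
  have "pderiv (z_pow (\<lambda>_. M)) = of_nat M * (\<Sum>j = 1..n. z_pow ((\<lambda>_. M)(j := M - 1)))"
    by (simp only: derivation_z_prod[OF ddt.derivation_axioms] ddt_t_minus_z mult_1_right sum_distrib_left)
  then show ?thesis
    by (simp only: ddt.mult ddt_exp_factor Psi_eq sum_distrib_left mult.left_commute[of _ "of_nat M"])
qed

lemma exp_trunc_eq: "exp_trunc d c = E - exp_top d c"
  by (simp add: exp_factor_eq)

lemma coeffs_in_Psi: "coeffs_in lam R (Psi p r s c n i)"
  unfolding Psi_eq by (intro coeffs_in_mult coeffs_in_exp_factor coeffs_in_z_prod)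

lemma coeffs_in_Phi2: "coeffs_in lam R (Phi2 i j)"
  unfolding Phi2_def by (intro coeffs_in_mult coeffs_in_exp_factor coeffs_in_z_prod)

section \<open>The coefficient functional and the equations modulo p^s\<close>

context
  fixes l :: nat
  assumes l_pos: "l > 0"
begin

text \<open>The algebraic substitute for integration in t: it is additive, and it sends
  t-derivatives of integral polynomials into p^s R. By \<open>l_pos\<close> the index is a genuine
  predecessor of l p^s.\<close>

definition functional :: "'k mpoly poly poly \<Rightarrow> 'k mpoly fract" where
  "functional P = at_lambda lam (Polynomial.coeff P (l * p ^ s - 1))"

lemma functional_simps:
  "functional (P + Q) = functional P + functional Q"
  "functional (P - Q) = functional P - functional Q"
  "functional (- P) = - functional P"
  "functional ([:f:] * P) = at_lambda lam f * functional P"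
  by (simp_all add: functional_def)

lemma functional_of_nat: "functional (of_nat k * P) = of_nat k * functional P"
  by (simp add: functional_def of_nat_poly at_lambda_def to_fract_of_nat)

lemma functional_sum: "functional (\<Sum>x \<in> A. f x) = (\<Sum>x \<in> A. functional (f x))"
  by (simp add: functional_def Polynomial.coeff_sum at_lambda_sum)

lemma functional_in: "coeffs_in lam S P \<Longrightarrow> functional P \<in> S"
  by (simp add: functional_def coeffs_in_def)

text \<open>The coefficient of \<open>t\<^bsup>l p\<^sup>s - 1\<^esup>\<close> in a \<open>t\<close>-derivative carries the factor \<open>l p\<^sup>s\<close>.\<close>

lemma functional_pderiv_in:
  assumes "coeffs_in lam R P"
  shows "functional (pderiv P) \<in> pR"
proof -
  have *: "Suc (l * p ^ s - 1) = l * p ^ s"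
    using l_pos p_gt_1 by simp
  have "functional (pderiv P) = of_nat (l * p ^ s) * at_lambda lam (Polynomial.coeff P (l * p ^ s))"
    by (simp only: functional_def coeff_pderiv * at_lambda_simps)
       (simp only: at_lambda_def poly_of_nat to_fract_of_nat)
  also have "\<dots> = of_nat p ^ s * (of_nat l * at_lambda lam (Polynomial.coeff P (l * p ^ s)))"
    by (simp add: mult_ac)
  finally show ?thesis
    using assms by (auto simp: coeffs_in_def intro: mult_in of_nat_in)
qed

lemma functional_Psi: "functional (Psi p r s c n i) = at_lambda lam (I_sol p r s l c n i)"
  by (simp add: functional_def I_sol_def)

lemma functional_ddz:
  "functional (ddz i (Psi p r s c n j)) = at_lambda lam (map_poly (mdiff i) (I_sol p r s l c n j))"
  by (simp add: functional_def I_sol_def coeff_map_poly)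

lemma functional_ddlam:
  "functional (ddlam (Psi p r s c n i)) = at_lambda lam (pderiv (I_sol p r s l c n i))"
  by (simp add: functional_def I_sol_def coeff_map_poly)

text \<open>Since z_i - z_j does not involve t, it passes through the functional in
  \<open>Psi_diff\<close> and cancels. The difference quotient is therefore the functional of a
  polynomial with integral coefficients.\<close>

lemma quotient_eq_functional:
  assumes "i \<in> {1..n}" "j \<in> {1..n}" "i \<noteq> j"
  shows "(at_lambda lam (I_sol p r s l c n i) - at_lambda lam (I_sol p r s l c n j)) /
    to_fract (mvar i - mvar j) = functional (Phi2 i j)"
proof -
  have "to_fract (mvar i - mvar j :: 'k mpoly) \<noteq> 0"
    using assms(3) by (simp add: mvar_eq_iff)
  moreover have "at_lambda lam (I_sol p r s l c n i) - at_lambda lam (I_sol p r s l c n j) =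
      to_fract (mvar i - mvar j) * functional (Phi2 i j)"
    by (simp only: functional_Psi[symmetric] functional_simps[symmetric] Psi_diff[OF assms])
       (simp only: functional_simps at_lambda_simps)
  ultimately show ?thesis
    by (metis nonzero_mult_div_cancel_left)
qed

text \<open>From p^s = 2 M + 1 one gets M + 1/2 = p^s / 2, so the exponent acts as -1/2 modulo
  p^s.\<close>

lemma half_ideal:
  assumes "x \<in> R"
  shows "(of_nat M + 1 / 2) * x \<in> pR"
proof -
  have "(of_nat M + 1 / 2) * x = of_nat p ^ s * (1 / 2 * x)"
    using two_neq_0 by (simp add: of_nat_p_pow field_simps)
  then show ?thesis
    using assms half_in mult_in by blast
qed

lemma KZ_off_diagonal:
  assumes "i \<in> {1..n}" "j \<in> {1..n}" "i \<noteq> j"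
  shows "at_lambda lam (map_poly (mdiff i) (I_sol p r s l c n j)) -
    1 / 2 * ((at_lambda lam (I_sol p r s l c n i) - at_lambda lam (I_sol p r s l c n j)) /
      to_fract (mvar i - mvar j)) \<in> pR"
proof -
  let ?F = "functional (Phi2 i j)"
  have "at_lambda lam (map_poly (mdiff i) (I_sol p r s l c n j)) = - (of_nat M * ?F)"
    by (simp only: functional_ddz[symmetric] ddz_Psi_other[OF assms] functional_simps functional_of_nat)
  moreover have "- (of_nat M * ?F) - 1 / 2 * ?F = - ((of_nat M + 1 / 2) * ?F)"
    by (simp add: algebra_simps)
  moreover have "- ((of_nat M + 1 / 2) * ?F) \<in> pR"
    by (intro ideal_uminus half_ideal functional_in coeffs_in_Phi2)
  ultimately show ?thesis
    unfolding quotient_eq_functional[OF assms] by (simp only:)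
qed

text \<open>\<open>ddz_plus_ddt_Psi\<close> is solved for the z_i-derivative, and
  \<open>exp_trunc\<close> is replaced by \<open>E - exp_top\<close>. The part with \<open>E\<close>
  gives the term c \<lambda> I_i; the top term, the t-derivative and the discrepancy M + 1/2 all
  land in p^s R.\<close>

lemma KZ_diagonal:
  assumes "i \<in> {1..n}"
  shows "at_lambda lam (map_poly (mdiff i) (I_sol p r s l c n i)) -
    (to_fract (mconst c) * to_fract (mconst lam) * at_lambda lam (I_sol p r s l c n i) -
      1 / 2 * (\<Sum>j \<in> {1..n} - {i}.
        (at_lambda lam (I_sol p r s l c n i) - at_lambda lam (I_sol p r s l c n j)) /
          to_fract (mvar i - mvar j))) \<in> pR"
proof -
  let ?Psi = "Psi p r s c n i"
  let ?cl = "[:[:0, mconst c:]:] :: 'k mpoly poly poly"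
  let ?Z = "z_pow ((\<lambda>_. M)(i := M - 1))"
  let ?S = "\<Sum>j \<in> {1..n} - {i}. functional (Phi2 i j)"
  have quot: "(\<Sum>j \<in> {1..n} - {i}.
        (at_lambda lam (I_sol p r s l c n i) - at_lambda lam (I_sol p r s l c n j)) /
          to_fract (mvar i - mvar j)) = ?S"
    using assms by (intro sum.cong refl quotient_eq_functional) auto
  have "ddz i ?Psi = ?cl * ?Psi + of_nat M * (\<Sum>j \<in> {1..n} - {i}. Phi2 i j) -
      exp_top d c * ?cl * ?Z - pderiv ?Psi"
    using ddz_plus_ddt_Psi[OF assms]
    by (simp only: exp_trunc_eq left_diff_distrib Psi_eq[of p r s c n i] eq_diff_eq mult_ac) (simp add: algebra_simps)
  then have "functional (ddz i ?Psi) =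
      to_fract (mconst lam) * to_fract (mconst c) * functional ?Psi + of_nat M * ?S -
      functional (exp_top d c * ?cl * ?Z) - functional (pderiv ?Psi)"
    by (simp only: functional_simps functional_of_nat functional_sum at_lambda_simps to_fract_0 add_0_left)
  then have "functional (ddz i ?Psi) -
      (to_fract (mconst c) * to_fract (mconst lam) * functional ?Psi - 1 / 2 * ?S) =
      (of_nat M + 1 / 2) * ?S - functional (exp_top d c * ?cl * ?Z) - functional (pderiv ?Psi)"
    by (simp add: algebra_simps)
  moreover have "\<dots> \<in> pR"
    by (intro ideal_diff half_ideal sum_in functional_in coeffs_in_Phi2 functional_pderiv_in
        coeffs_in_Psi coeffs_in_ideal_mult coeffs_in_top_lam coeffs_in_z_prod)
  ultimately show ?thesis
    unfolding quot functional_Psi functional_ddz by (simp only:)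
qed

text \<open>The \<lambda>-derivative multiplies the integrand by c t, up to the top term. Splitting
  t into z_i and t - z_i gives the term c z_i I_i plus c times the functional of the full product,
  and the latter is evaluated through its t-derivative by \<open>ddt_master\<close>.\<close>

lemma dynamical:
  assumes "i \<in> {1..n}" and "lam * y = 1" and y_in: "to_fract (mconst y) \<in> R"
  shows "at_lambda lam (pderiv (I_sol p r s l c n i)) -
    (to_fract (mconst c) * to_fract (mvar i) * at_lambda lam (I_sol p r s l c n i) +
      1 / (2 * to_fract (mconst lam)) * (\<Sum>j = 1..n. at_lambda lam (I_sol p r s l c n j))) \<in> pR"
proof -
  let ?Psi = "Psi p r s c n"
  let ?cl = "[:[:0, mconst c:]:] :: 'k mpoly poly poly"
  let ?ct = "[:0, [:mconst c:]:] :: 'k mpoly poly poly"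
  let ?cc = "[:[:mconst c:]:] :: 'k mpoly poly poly"
  let ?F = "z_pow (\<lambda>_. M)" and ?Z = "z_pow ((\<lambda>_. M)(i := M - 1))"
  let ?c = "to_fract (mconst c)" and ?l = "to_fract (mconst lam)" and ?y = "to_fract (mconst y)"
  let ?S = "\<Sum>j = 1..n. functional (?Psi j)"
  have F: "?F = t_minus_z i * ?Z"
    using assms M_pos by (subst z_prod_remove[of i]) auto
  \<comment> \<open>This is c t = c (t - z_i) + c z_i; by \<open>F\<close>, the factor t - z_i
    completes \<open>?Z\<close> to the full product \<open>?F\<close>.\<close>
  have ct: "?ct = ?cc * t_minus_z i + [:[:mconst c * mvar i:]:]"
    by (simp add: t_minus_z_def)
  have "exp_trunc d c * ?ct * ?Z = ?ct * (E * ?Z) - exp_top d c * ?ct * ?Z"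
    by (simp only: exp_trunc_eq left_diff_distrib right_diff_distrib mult_ac)
  also have "?ct * (E * ?Z) = ?cc * (E * ?F) + [:[:mconst c * mvar i:]:] * (E * ?Z)"
    unfolding F ct by (simp only: distrib_left distrib_right mult_ac)
  finally have lhs: "functional (ddlam (?Psi i)) =
      ?c * functional (E * ?F) + ?c * to_fract (mvar i) * functional (?Psi i) -
      functional (exp_top d c * ?ct * ?Z)"
    unfolding ddlam_Psi unfolding Psi_eq[of p r s c n i]
    by (simp only: functional_simps at_lambda_simps to_fract_mult)
  have "pderiv (E * ?F) = ?cl * (E * ?F) - exp_top d c * ?cl * ?F + of_nat M * (\<Sum>j = 1..n. ?Psi j)"
    unfolding ddt_master by (simp only: exp_trunc_eq left_diff_distrib right_diff_distrib mult_ac)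
  then have ddt: "functional (pderiv (E * ?F)) =
      ?l * ?c * functional (E * ?F) - functional (exp_top d c * ?cl * ?F) + of_nat M * ?S"
    by (simp only: functional_simps functional_of_nat functional_sum at_lambda_simps to_fract_0 add_0_left)
  have ly: "?l * ?y = 1"
    by (simp only: to_fract_mult[symmetric] mconst_mult[symmetric] assms(2) mconst_1 to_fract_1)
  have solve: "a = y * (l * a - t + m + t - m)" if "l * y = 1" for a l y t m :: "'k mpoly fract"
    using that by (simp add: mult.commute[of y l] flip: mult.assoc)
  \<comment> \<open>The identity \<open>ddt\<close> determines only \<lambda> c times this
    functional. Multiplying by the inverse \<open>?y\<close> isolates it, and \<open>y_in\<close>
    keeps the correction terms in p^s R.\<close>
  have c_eq: "?c * functional (E * ?F) =
      ?y * (functional (pderiv (E * ?F)) + functional (exp_top d c * ?cl * ?F) - of_nat M * ?S)"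
    unfolding ddt mult.assoc[of ?l] by (rule solve[OF ly])
  have y_eq: "1 / (2 * ?l) = ?y * (1 / 2)"
    using inverse_unique[OF ly] by (simp only: divide_inverse inverse_mult_distrib mult_1_left mult_ac)
  have rearrange: "y * (u + v - m * x) + w - t - (w + y * (1 / 2) * x) = (u + v - (m + 1 / 2) * x) * y - t"
    for y u v m x w t :: "'k mpoly fract"
    by (simp add: algebra_simps)
  have "functional (ddlam (?Psi i)) -
      (?c * to_fract (mvar i) * functional (?Psi i) + 1 / (2 * ?l) * ?S) =
      (functional (pderiv (E * ?F)) + functional (exp_top d c * ?cl * ?F) - (of_nat M + 1 / 2) * ?S) * ?y -
      functional (exp_top d c * ?ct * ?Z)"
    unfolding lhs c_eq y_eq by (rule rearrange)
  moreover have "\<dots> \<in> pR"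
    by (intro ideal_diff ideal_add ideal_mult y_in half_ideal sum_in functional_in functional_pderiv_in
        coeffs_in_Psi coeffs_in_ideal_mult coeffs_in_top_lam coeffs_in_top_t coeffs_in_z_prod
        coeffs_in_mult coeffs_in_exp_factor)
  ultimately show ?thesis
    unfolding functional_Psi functional_ddlam by (simp only:)
qed

end

end


section \<open>Arithmetic in \<open>\<int>\<^sub>p[\<alpha>]\<close>\<close>

text \<open>Among 1, ..., k the multiples of p are p, 2p, ..., (k div p) p. Taking one p out of each
  leaves (k div p)!, and the remaining factors are prime to p.\<close>

lemma fact_eq_prime_power_times_fact_div:
  fixes p :: nat
  assumes "Factorial_Ring.prime p"
  shows "\<exists>u. fact k = p ^ (k div p) * fact (k div p) * u \<and> coprime u p"
proof (induction k)
  case (Suc k)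
  then obtain u where u: "fact k = p ^ (k div p) * fact (k div p) * u" "coprime u p"
    by blast
  show ?case
  proof (cases "p dvd Suc k")
    case True
    then have "Suc k mod p = 0"
      by simp
    then have div: "Suc k div p = Suc (k div p)"
      by (simp add: div_Suc)
    have "Suc k = p * (Suc k div p)"
      using True by (simp only: dvd_mult_div_cancel)
    then have "Suc k * fact k = p * Suc (k div p) * (p ^ (k div p) * fact (k div p) * u)"
      by (simp only: u(1) div)
    then have "fact (Suc k) = p ^ (Suc k div p) * fact (Suc k div p) * u"
      by (simp only: div fact_Suc of_nat_id power_Suc mult_ac)
    with u(2) show ?thesis
      by blast
  next
    case False
    then have "Suc k mod p \<noteq> 0"
      by (metis mod_0_imp_dvd)
    then have div: "Suc k div p = k div p"
      by (simp add: div_Suc)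
    have "fact (Suc k) = p ^ (Suc k div p) * fact (Suc k div p) * (Suc k * u)"
      by (simp only: div fact_Suc of_nat_id u(1) mult_ac)
    moreover have "coprime (Suc k) p"
      using prime_imp_coprime[OF assms False] by (simp only: coprime_commute)
    then have "coprime (Suc k * u) p"
      using u(2) by (simp only: coprime_mult_left_iff)
    ultimately show ?thesis
      by blast
  qed
qed (auto intro: exI[of _ 1])

text \<open>Legendre's bound by iteration: with j = k div p, the valuation of k! is j plus that of
  j!, and (p - 1) j + j = p j \<le> k.\<close>

lemma fact_valuation_bound:
  fixes p :: nat
  assumes p: "Factorial_Ring.prime p"
  shows "\<exists>m u. fact k = p ^ m * u \<and> coprime u p \<and> (p - 1) * m \<le> k"
proof (induction k rule: less_induct)
  case (less k)
  show ?case
  proof (cases "k = 0")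
    case False
    let ?j = "k div p"
    have "?j < k"
      using False prime_gt_1_nat[OF p] by simp
    then obtain m u where u: "fact ?j = p ^ m * u" "coprime u p" "(p - 1) * m \<le> ?j"
      using less by blast
    obtain v where v: "fact k = p ^ ?j * fact ?j * v" "coprime v p"
      using fact_eq_prime_power_times_fact_div[OF p] by blast
    have "(p - 1) * (?j + m) \<le> (p - 1) * ?j + ?j"
      using u(3) by (simp add: distrib_left)
    also have "\<dots> = p * ?j"
      using prime_gt_0_nat[OF p] by (simp add: algebra_simps)
    also have "\<dots> \<le> k"
      by simp
    finally have "(p - 1) * (?j + m) \<le> k" .
    moreover have "fact k = p ^ (?j + m) * (u * v)"
      using u(1) v(1) by (simp add: power_add mult_ac)
    moreover have "coprime (u * v) p"
      using u(2) v(2) by simp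
    ultimately show ?thesis
      by blast
  qed (auto intro!: exI[of _ 0])
qed

section \<open>Natural numbers in the p-adic integers\<close>

lemma Rep_padic_int_of_nat:
  "Rep_padic_int (of_nat k :: 'p :: prime_card padic_int) m = int k mod int CARD('p) ^ m"
  by (induction k) (simp_all add: zero_padic_int.rep_eq one_padic_int.rep_eq plus_padic_int.rep_eq mod_simps)

lemma padic_of_nat_neq_0:
  assumes "k > 0"
  shows "(of_nat k :: 'p :: prime_card padic_int) \<noteq> 0"
proof
  assume "(of_nat k :: 'p padic_int) = 0"
  \<comment> \<open>Level \<open>k\<close> is high enough to detect \<open>k\<close>, because k <
    2^k \<le> p^k makes the residue equal to \<open>k\<close> itself.\<close>
  then have "int k mod int CARD('p) ^ k = 0"
    by (metis Rep_padic_int_of_nat zero_padic_int.rep_eq)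
  moreover have "int k < int CARD('p) ^ k"
    using of_nat_less_two_power[of k, where 'a = int] card_gt_1_int[where 'p = 'p]
      power_mono[of 2 "int CARD('p)" k] by linarith
  ultimately show False
    using assms by simp
qed

text \<open>Inverses are chosen independently modulo each p^m. They form a compatible sequence
  because \<open>k\<close> can be cancelled modulo p^m, which makes inverses unique there.\<close>

lemma padic_unit_of_coprime:
  assumes "coprime k CARD('p :: prime_card)"
  shows "\<exists>y :: 'p padic_int. of_nat k * y = 1"
proof -
  let ?q = "int CARD('p)"
  have cop: "coprime (int k) (?q ^ m)" for m
    using assms by simp
  then have "\<forall>m. \<exists>x. [int k * x = 1] (mod ?q ^ m)"
    using cong_solve_coprime_int by blast
  then obtain f where f: "\<And>m. [int k * f m = 1] (mod ?q ^ m)"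
    by metis
  have "[int k * f (Suc m) = int k * f m] (mod ?q ^ m)" for m
    using f[of m] cong_dvd_modulus[OF f[of "Suc m"], of "?q ^ m"] cong_trans cong_sym le_imp_power_dvd[of m "Suc m"]
    by (meson lessI less_imp_le)
  then have "[f (Suc m) = f m] (mod ?q ^ m)" for m
    using cop cong_mult_lcancel by blast
  then have mem: "(\<lambda>m. f m mod ?q ^ m) \<in> padic_seqs ?q"
    by (intro padic_seqs_mod card_gt_0_int) (simp add: cong_def)
  let ?y = "Abs_padic_int (\<lambda>m. f m mod ?q ^ m) :: 'p padic_int"
  have "Rep_padic_int (of_nat k * ?y) m = Rep_padic_int (1 :: 'p padic_int) m" for m
  proof -
    have "Rep_padic_int (of_nat k * ?y) m = (int k mod ?q ^ m * (f m mod ?q ^ m)) mod ?q ^ m"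
      by (simp only: times_padic_int.rep_eq Rep_padic_int_of_nat Abs_padic_int_inverse[OF mem])
    also have "\<dots> = 1 mod ?q ^ m"
      using f[of m] by (simp only: mod_mult_eq cong_def)
    finally show ?thesis
      by (simp only: one_padic_int.rep_eq)
  qed
  then have "Rep_padic_int (of_nat k * ?y) = Rep_padic_int (1 :: 'p padic_int)"
    by (rule ext)
  then have "of_nat k * ?y = 1"
    by (simp only: Rep_padic_int_inject)
  then show ?thesis
    by blast
qed

section \<open>Passage to the algebraic closure and to the generated rings\<close>

lemma of_padic_int_1 [simp]: "of_padic_int 1 = 1"
  and of_padic_int_mult [simp]: "of_padic_int (x * y) = of_padic_int x * of_padic_int y"
  and of_padic_int_of_nat [simp]: "of_padic_int (of_nat k) = of_nat k"
  by (simp_all add: of_padic_int_def to_fract_of_nat)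

lemma qp_closure_of_nat_neq_0:
  assumes "k > 0"
  shows "(of_nat k :: 'p :: prime_card qp_closure) \<noteq> 0"
  using padic_of_nat_neq_0[OF assms, where 'p = 'p]
  unfolding of_padic_int_of_nat[symmetric] of_padic_int_def by simp

text \<open>Carries the closure rules of the carrier-based \<open>generate_ring\<close> over to the
  type-class operations; the two additive inverses agree by uniqueness.\<close>

lemma generate_ring_closed:
  fixes H :: "'a :: comm_ring_1 set"
  defines "G \<equiv> generate_ring ring_of_type_algebra H"
  shows "1 \<in> G" and "x \<in> H \<Longrightarrow> x \<in> G" and "x \<in> G \<Longrightarrow> - x \<in> G"
    and "x \<in> G \<Longrightarrow> y \<in> G \<Longrightarrow> x + y \<in> G" and "x \<in> G \<Longrightarrow> y \<in> G \<Longrightarrow> x * y \<in> G"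
proof -
  interpret cring "ring_of_type_algebra :: 'a ring"
    by (rule cring_from_type_algebra)
  have "\<ominus>\<^bsub>ring_of_type_algebra\<^esub> z = - z" for z :: 'a
    by (rule minus_equality) (simp_all add: ring_of_type_algebra_def)
  then show "1 \<in> G" "x \<in> H \<Longrightarrow> x \<in> G" "x \<in> G \<Longrightarrow> - x \<in> G"
    "x \<in> G \<Longrightarrow> y \<in> G \<Longrightarrow> x + y \<in> G" "x \<in> G \<Longrightarrow> y \<in> G \<Longrightarrow> x * y \<in> G"
    using generate_ring.intros[where R = ring_of_type_algebra and H = H]
    unfolding G_def by (simp_all add: ring_of_type_algebra_def)
qed

lemmas Zp_adjoin_closed = generate_ring_closed[where H = "range of_padic_int \<union> {\<alpha>}" for \<alpha>, folded Zp_adjoin_def]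

lemma of_padic_int_in_Zp_adjoin: "of_padic_int x \<in> Zp_adjoin \<alpha>"
  by (rule Zp_adjoin_closed(2)) blast

lemma alpha_power_in_Zp_adjoin: "\<alpha> ^ k \<in> Zp_adjoin \<alpha>"
  by (induction k) (simp_all add: Zp_adjoin_closed(1,2,5))

lemma inverse_of_nat_in_Zp_adjoin:
  fixes \<alpha> :: "'p :: prime_card qp_closure"
  assumes "coprime k CARD('p)"
  shows "1 / of_nat k \<in> Zp_adjoin \<alpha>"
proof -
  obtain y :: "'p padic_int" where "of_nat k * y = 1"
    using padic_unit_of_coprime[OF assms] by blast
  then have "of_nat k * of_padic_int y = 1"
    by (metis of_padic_int_1 of_padic_int_mult of_padic_int_of_nat)
  then have "1 / of_nat k = of_padic_int y"
    by (metis mult_zero_left nonzero_mult_div_cancel_left zero_neq_one)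
  then show ?thesis
    by (simp add: of_padic_int_in_Zp_adjoin)
qed

text \<open>With \<alpha> of valuation 1/r2, the second hypothesis reads a/r2 \<ge> k/(p - 1) + e,
  with denominators cleared to stay in the natural numbers. As k! has valuation at most k/(p - 1), a
  factor p^e remains after dividing.\<close>

lemma alpha_power_div_fact:
  fixes \<alpha> :: "'p :: prime_card qp_closure"
  assumes "\<alpha> ^ r2 = of_nat CARD('p)" and "(CARD('p) - 1) * a \<ge> r2 * (k + (CARD('p) - 1) * e)"
  shows "\<exists>x \<in> Zp_adjoin \<alpha>. 1 / of_nat (fact k) * \<alpha> ^ a = of_nat CARD('p) ^ e * x"
proof -
  let ?p = "CARD('p)"
  have p: "Factorial_Ring.prime ?p"
    by (rule prime_card)
  obtain m u where mu: "fact k = ?p ^ m * u" "coprime u ?p" "(?p - 1) * m \<le> k"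
    using fact_valuation_bound[OF p] by blast
  \<comment> \<open>Cancelling p - 1 yields r2 (m + e) \<le> a: enough powers of \<alpha> to cancel
    the factor p^m of k! and still extract p^e.\<close>
  have "(?p - 1) * (r2 * (m + e)) \<le> r2 * (k + (?p - 1) * e)"
    using mult_le_mono2[OF mu(3), of r2] by (simp add: algebra_simps)
  also note assms(2)
  finally have "r2 * (m + e) \<le> a"
    using prime_gt_1_nat[OF p] by simp
  then have "\<alpha> ^ a = \<alpha> ^ (r2 * (m + e)) * \<alpha> ^ (a - r2 * (m + e))"
    by (simp flip: power_add)
  also have "\<alpha> ^ (r2 * (m + e)) = of_nat ?p ^ m * of_nat ?p ^ e"
    by (simp add: power_mult assms(1) power_add)
  finally have "1 / of_nat (fact k) * \<alpha> ^ a = of_nat ?p ^ e * (1 / of_nat u * \<alpha> ^ (a - r2 * (m + e)))"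
    using qp_closure_of_nat_neq_0[of ?p, where 'p = 'p] prime_gt_0_nat[OF p]
    by (simp add: mu(1) field_simps)
  then show ?thesis
    using Zp_adjoin_closed(5)[OF inverse_of_nat_in_Zp_adjoin[OF mu(2)] alpha_power_in_Zp_adjoin] by blast
qed

text \<open>The \<open>+ 1\<close> after the integer part makes the inequality strict. It says d (r
  - 1/(p - 1)) > s, multiplied by p - 1.\<close>

lemma trunc_deg_gt:
  assumes "r > 1 / (real p - 1)" and "p > 1"
  shows "real (trunc_deg p r s) * (r * (real p - 1) - 1) > real s * (real p - 1)"
proof -
  have pos: "r * (real p - 1) - 1 > 0"
    using assms by (simp add: field_simps)
  have "real s * ((real p - 1) / (r * (real p - 1) - 1)) < real (trunc_deg p r s)"
    unfolding trunc_deg_def by linarith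
  with pos show ?thesis
    by (simp add: field_simps)
qed

section \<open>The localised ring satisfies the conditions of \<open>integral_data\<close>\<close>

lemmas loc_ring_closed = generate_ring_closed[where H =
  "(\<lambda>c. to_fract (mconst c)) ` Zp_adjoin \<alpha> \<union> (\<lambda>i. to_fract (mvar i)) ` {1..n} \<union>
   {inverse (to_fract (mvar i - mvar j)) | i j. i \<in> {1..n} \<and> j \<in> {1..n} \<and> i \<noteq> j}" for \<alpha> n,
  folded loc_ring_def]

lemma mconst_in_loc_ring: "x \<in> Zp_adjoin \<alpha> \<Longrightarrow> to_fract (mconst x) \<in> loc_ring \<alpha> n"
  by (rule loc_ring_closed(2)) blast

lemma integral_data_loc_ring:
  fixes \<alpha> :: "'p :: prime_card qp_closure"
  assumes p: "p = CARD('p)" and "odd p" and "s > 0" and "r2 > 0"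
    and r: "r = real r1 / real r2" "r > 1 / (real p - 1)"
    and \<alpha>: "\<alpha> ^ r2 = of_nat p" and lam: "lam \<in> Zp_adjoin \<alpha>"
  shows "integral_data p s n r (\<alpha> ^ r1) lam (loc_ring \<alpha> n)"
proof
  let ?d = "trunc_deg p r s"
  show p1: "p > 1"
    using card_gt_1_int[where 'p = 'p] p by simp
  have p_minus_1: "real (p - 1) = real p - 1"
    using p1 by simp
  have "1 < r * (real p - 1)"
    using r(2) p1 by (simp add: field_simps)
  then have "real r2 * 1 < real r2 * (r * (real p - 1))"
    using \<open>r2 > 0\<close> by (intro mult_strict_left_mono) auto
  then have "real r2 < (real p - 1) * real r1"
    using \<open>r2 > 0\<close> by (simp add: r(1) mult.commute)
  also have "\<dots> = real ((p - 1) * r1)"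
    by (simp only: of_nat_mult p_minus_1)
  \<comment> \<open>This is r > 1/(p - 1) with denominators cleared; it is what makes every c^k/k!
    integral.\<close>
  finally have r12: "r2 \<le> (p - 1) * r1"
    by (simp only: of_nat_less_iff less_imp_le)
  show "to_fract (mconst (1 / of_nat (fact k) * (\<alpha> ^ r1) ^ k)) \<in> loc_ring \<alpha> n" for k
  proof -
    \<comment> \<open>The case \<open>e = 0\<close> of \<open>alpha_power_div_fact\<close>:
      integrality only, with no power of p extracted.\<close>
    have "r2 * (k + (p - 1) * 0) \<le> (p - 1) * (r1 * k)"
      using mult_le_mono1[OF r12, of k] by (simp add: mult_ac)
    then have "1 / of_nat (fact k) * \<alpha> ^ (r1 * k) \<in> Zp_adjoin \<alpha>"
      using alpha_power_div_fact[of \<alpha> r2 k 0 "r1 * k"] \<alpha> p by auto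
    then show ?thesis
      by (intro mconst_in_loc_ring) (simp add: power_mult)
  qed
  show "to_fract (mconst (1 / of_nat (fact ?d) * (\<alpha> ^ r1) ^ Suc ?d))
      \<in> (\<lambda>x. of_nat p ^ s * x) ` loc_ring \<alpha> n"
  proof -
    \<comment> \<open>The inequality \<open>trunc_deg_gt\<close> is scaled by \<open>r2\<close> to
      become the natural-number hypothesis of \<open>alpha_power_div_fact\<close> with
      \<open>e = s\<close>; it then passes from exponent r1 d to r1 (d + 1) by monotonicity.\<close>
    have "real r2 * (real s * (real p - 1)) < real r2 * (real ?d * (r * (real p - 1) - 1))"
      using trunc_deg_gt[OF r(2) p1] \<open>r2 > 0\<close> by simp
    also have "\<dots> = (real p - 1) * real r1 * real ?d - real r2 * real ?d"
      using \<open>r2 > 0\<close> by (simp add: r(1) field_simps)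
    finally have "real (r2 * (?d + (p - 1) * s)) \<le> real ((p - 1) * (r1 * ?d))"
      unfolding of_nat_mult of_nat_add p_minus_1 by (simp add: algebra_simps)
    then have "r2 * (?d + (p - 1) * s) \<le> (p - 1) * (r1 * ?d)"
      by (simp only: of_nat_le_iff)
    also have "\<dots> \<le> (p - 1) * (r1 * Suc ?d)"
      by simp
    finally obtain x where "x \<in> Zp_adjoin \<alpha>"
      "1 / of_nat (fact ?d) * \<alpha> ^ (r1 * Suc ?d) = of_nat p ^ s * x"
      using alpha_power_div_fact[of \<alpha> r2 ?d s "r1 * Suc ?d"] \<alpha> p by auto
    then have "to_fract (mconst (1 / of_nat (fact ?d) * (\<alpha> ^ r1) ^ Suc ?d)) =
        of_nat p ^ s * to_fract (mconst x)"
      by (simp only: power_mult[symmetric] mconst_mult[of "of_nat p ^ s"] mconst_power mconst_of_nat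
          to_fract_mult to_fract_power to_fract_of_nat)
    then show ?thesis
      using mconst_in_loc_ring[OF \<open>x \<in> Zp_adjoin \<alpha>\<close>] by (rule image_eqI)
  qed
  show "1 / 2 \<in> loc_ring \<alpha> n"
  proof -
    have "coprime 2 CARD('p)"
      using assms by (simp add: coprime_left_2_iff_odd)
    then have "1 / of_nat 2 \<in> Zp_adjoin \<alpha>"
      by (rule inverse_of_nat_in_Zp_adjoin)
    moreover have "to_fract (mconst (1 / of_nat 2 :: 'p qp_closure)) * 2 = 1"
    proof -
      have "mconst (1 / of_nat 2 :: 'p qp_closure) * of_nat 2 = 1"
        using qp_closure_of_nat_neq_0[of 2, where 'p = 'p]
        by (simp only: mconst_of_nat[symmetric] mconst_mult[symmetric]) simp
      then show ?thesis
        by (metis to_fract_1 to_fract_mult to_fract_of_nat of_nat_numeral)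
    qed
    ultimately show ?thesis
      by (metis mconst_in_loc_ring mult_zero_right nonzero_eq_divide_eq zero_neq_one)
  qed
  show "to_fract (mvar i) \<in> loc_ring \<alpha> n" if "i \<in> {1..n}" for i
    using that by (intro loc_ring_closed(2)) blast
  show "to_fract (mconst lam) \<in> loc_ring \<alpha> n"
    by (rule mconst_in_loc_ring[OF lam])
qed (fact loc_ring_closed assms qp_closure_of_nat_neq_0)+

theorem theorem1p8:
  fixes p g s l r1 r2 :: nat and r :: real
    and \<alpha> :: "'p :: prime_card qp_closure"
  assumes "p = CARD('p)" and "odd p"
    and "g > 0" and "s > 0" and "l > 0"
    and "r1 > 0" and "r2 > 0" and "coprime r1 r2"
    and "r = real r1 / real r2" and "r > 1 / (real p - 1)"
    and "\<alpha> ^ r2 = of_nat p"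
  shows "(\<forall>lam \<in> Zp_adjoin \<alpha>.
            KZ_solution_mod \<alpha> (\<alpha> ^ r1) (2 * g + 1) s lam
              (I_sol p r s l (\<alpha> ^ r1) (2 * g + 1))) \<and>
         (\<forall>lam \<in> Zp_adjoin_units \<alpha>.
            dynamical_solution_mod \<alpha> (\<alpha> ^ r1) (2 * g + 1) s lam
              (I_sol p r s l (\<alpha> ^ r1) (2 * g + 1)))"
proof (intro conjI ballI)
  fix lam assume "lam \<in> Zp_adjoin \<alpha>"
  then interpret integral_data p s "2 * g + 1" r "\<alpha> ^ r1" lam "loc_ring \<alpha> (2 * g + 1)"
    using assms by (intro integral_data_loc_ring)
  show "KZ_solution_mod \<alpha> (\<alpha> ^ r1) (2 * g + 1) s lam (I_sol p r s l (\<alpha> ^ r1) (2 * g + 1))"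
    unfolding KZ_solution_mod_def eq_mod_ps_def assms(1)[symmetric]
    using KZ_off_diagonal[OF \<open>l > 0\<close>] KZ_diagonal[OF \<open>l > 0\<close>] by blast
next
  fix lam assume "lam \<in> Zp_adjoin_units \<alpha>"
  \<comment> \<open>The inverse of \<lambda> lies in \<open>Zp_adjoin \<alpha>\<close> itself, so
    the division by \<lambda> in the dynamical equations stays inside the localised ring.\<close>
  then obtain y where lam: "lam \<in> Zp_adjoin \<alpha>" and y: "y \<in> Zp_adjoin \<alpha>" "lam * y = 1"
    by (auto simp: Zp_adjoin_units_def)
  interpret integral_data p s "2 * g + 1" r "\<alpha> ^ r1" lam "loc_ring \<alpha> (2 * g + 1)"
    using assms lam by (intro integral_data_loc_ring)
  show "dynamical_solution_mod \<alpha> (\<alpha> ^ r1) (2 * g + 1) s lam (I_sol p r s l (\<alpha> ^ r1) (2 * g + 1))"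
    unfolding dynamical_solution_mod_def eq_mod_ps_def assms(1)[symmetric]
    using dynamical[OF \<open>l > 0\<close> _ y(2) mconst_in_loc_ring[OF y(1)]] by blast
qed

end
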